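(* Let $A\in\mathbb{C}^{m\times n}$, $A\ne O$, and $\mathbf{b}\in\mathrm{range}(A)$. Let $(\Delta A,\Delta\mathbf{b})\in\mathbb{C}^{m\times n}\times\mathbb{C}^m$ be such that $\mathrm{rank}(\tilde A)=\mathrm{rank}(A)$ and $\tilde{\mathbf{b}}\in\mathrm{range}(\tilde A)$, where $\tilde A=A+\Delta A$ and $\tilde{\mathbf{b}}=\mathbf{b}+\Delta\mathbf{b}$. Let $\mathbf{x}_*=A^\dagger\mathbf{b}$. If $\sqrt2\,\|A^\dagger\|_2\,\|\Delta A\|_2<1$, then $$\mathrm{dist}\big(\mathrm{sol}(\tilde A,\tilde{\mathbf{b}}),\,\mathrm{sol}(A,\mathbf{b})\big)\le \|A\|_2\,\|A^\dagger\|_2\cdot\frac{\sqrt{2\|\mathbf{x}_*\|_2^2+1}}{\|A\|_2-\sqrt2\,\|A\|_2\,\|A^\dagger\|_2\,\|\Delta A\|_2}\,\|(\Delta A,\Delta\mathbf{b})\|.$$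
   Context: $A^\dagger$ is the Moore-Penrose inverse, $\|\cdot\|_2$ the Euclidean norm of vectors and the spectral norm of matrices, and $\|(G,\mathbf{d})\|:=\sqrt{\|G\|_2^2+\|\mathbf{d}\|_2^2}$ for $(G,\mathbf{d})\in\mathbb{C}^{m\times n}\times\mathbb{C}^m$. $\mathrm{sol}(G,\mathbf{d}):=\{\mathbf{u}\in\mathbb{C}^n: G\mathbf{u}=\mathbf{d}\}$. If $\mathbf{d}\in\mathrm{range}(G)$ and $\mathrm{rank}(G)=r$, then $\mathrm{sol}(G,\mathbf{d})=G^\dagger\mathbf{d}+\ker G$ is an $(n-r)$-dimensional affine subspace of $\mathbb{C}^n$. For subspaces $\mathcal{P},\mathcal{Q}$ of $\mathbb{C}^n$ of equal dimension, $\mathrm{dist}(\mathcal{P},\mathcal{Q})=\|PP^{H}-QQ^{H}\|_2$, where the columns of $P,Q$ form orthonormal bases of $\mathcal{P},\mathcal{Q}$. For affine subspaces $\mathbf{u}_1+\mathcal{V}_1$, $\mathbf{u}_2+\mathcal{V}_2$ of equal dimension, $\mathrm{dist}(\mathbf{u}_1+\mathcal{V}_1,\mathbf{u}_2+\mathcal{V}_2)=\max\{\|\hat{\mathbf{u}}_1-\hat{\mathbf{u}}_2\|_2,\ \mathrm{dist}(\mathcal{V}_1,\mathcal{V}_2)\}$, where $\hat{\mathbf{u}}_j$ is the unique (minimum norm) element of $\mathcal{V}_j^\perp\cap(\mathbf{u}_j+\mathcal{V}_j)$. Thus for consistent systems of the same rank, $\mathrm{dist}(\mathrm{sol}(A,\mathbf{b}),\mathrm{sol}(B,\mathbf{d}))=\max\{\|A^\dagger\mathbf{b}-B^\dagger\mathbf{d}\|_2,\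 \mathrm{dist}(\ker A,\ker B)\}$. *)

theory Defs
  imports "HOL-Analysis.Analysis"
begin

text \<open>
  On \<^typ>\<open>complex^'n\<close> the library's \<^const>\<open>norm\<close> is the Euclidean norm, but its inner product is the
  real one, so the Hermitian inner product and the conjugate transpose are introduced here.
  Rank and linear span are the library's notions over the scalar field \<^typ>\<open>complex\<close>
  (\<^const>\<open>rank\<close>, \<^term>\<open>vec.span\<close>), not the real ones.
\<close>

definition hinner :: "complex^'n \<Rightarrow> complex^'n \<Rightarrow> complex" where
  "hinner u v = (\<Sum>i\<in>UNIV. u $ i * cnj (v $ i))"

definition hermitian_transpose :: "complex^'n^'m \<Rightarrow> complex^'m^'n" where
  "hermitian_transpose A = map_matrix cnj (transpose A)"

text \<open>Operator norm induced by the Euclidean norms.\<close>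

definition spectral_norm :: "complex^'n^'m \<Rightarrow> real" where
  "spectral_norm A = onorm (\<lambda>x. A *v x)"

text \<open>The four Penrose equations, which determine \<open>X\<close> uniquely.\<close>

definition is_moore_penrose :: "complex^'n^'m \<Rightarrow> complex^'m^'n \<Rightarrow> bool" where
  "is_moore_penrose A X \<longleftrightarrow>
     A ** X ** A = A \<and> X ** A ** X = X \<and>
     hermitian_transpose (A ** X) = A ** X \<and> hermitian_transpose (X ** A) = X ** A"

definition pinv :: "complex^'n^'m \<Rightarrow> complex^'m^'n" where
  "pinv A = (THE X. is_moore_penrose A X)"

definition pair_norm :: "complex^'n^'m \<Rightarrow> complex^'m \<Rightarrow> real" where
  "pair_norm G d = sqrt ((spectral_norm G)\<^sup>2 + (norm d)\<^sup>2)"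

definition sol :: "complex^'n^'m \<Rightarrow> complex^'m \<Rightarrow> (complex^'n) set" where
  "sol G d = {u. G *v u = d}"

definition orthonormal_basis :: "(complex^'n) set \<Rightarrow> (complex^'n) set \<Rightarrow> bool" where
  "orthonormal_basis B V \<longleftrightarrow>
     finite B \<and> (\<forall>u\<in>B. \<forall>v\<in>B. hinner u v = (if u = v then 1 else 0)) \<and> vec.span B = V"

text \<open>
  If \<open>P\<close> is the matrix whose columns are the elements of \<open>B\<close> (in any order), then
  \<open>column_gram B\<close> is the product of \<open>P\<close> and its conjugate transpose. The number of columns depends on
  the subspace, so \<open>P\<close> itself is represented by its finite set of columns.
\<close>

definition column_gram :: "(complex^'n) set \<Rightarrow> complex^'n^'n" where
  "column_gram B = (\<chi> i j. \<Sum>v\<in>B. v $ i * cnj (v $ j))"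

text \<open>
  Meant for complex subspaces of equal dimension; the value does not depend on the choice of the two
  orthonormal bases.
\<close>

definition subspace_dist :: "(complex^'n) set \<Rightarrow> (complex^'n) set \<Rightarrow> real" where
  "subspace_dist V W =
     (THE \<delta>. \<exists>P Q. orthonormal_basis P V \<and> orthonormal_basis Q W \<and>
                  \<delta> = spectral_norm (column_gram P - column_gram Q))"

text \<open>For \<open>S = u + V\<close> with a subspace \<open>V\<close>, the direction of \<open>S\<close> is \<open>V\<close>.\<close>

definition direction :: "(complex^'n) set \<Rightarrow> (complex^'n) set" where
  "direction S = {x - y | x y. x \<in> S \<and> y \<in> S}"

definition hat_point :: "(complex^'n) set \<Rightarrow> complex^'n" where
  "hat_point S = (THE x. x \<in> S \<and> (\<forall>v\<in>direction S. hinner x v = 0))"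

text \<open>Meant for nonempty affine subspaces of equal dimension.\<close>

definition affine_dist :: "(complex^'n) set \<Rightarrow> (complex^'n) set \<Rightarrow> real" where
  "affine_dist S T =
     max (norm (hat_point S - hat_point T)) (subspace_dist (direction S) (direction T))"

end

theory Submission
  imports Defs
begin

text \<open>
Let \<open>P\<close> and \<open>Q\<close> be the orthogonal projectors onto the orthogonal complements of the kernels of
\<open>A\<close> and \<open>A + \<Delta>A\<close>, so \<open>P = pinv A ** A\<close>, and put \<open>\<eta> = spectral_norm (pinv A)\<close> and
\<open>e = spectral_norm \<Delta>A\<close>. On the kernel of \<open>A + \<Delta>A\<close> the matrix \<open>A\<close> equals \<open>- \<Delta>A\<close>, hence
\<open>P (1 - Q)\<close> has norm at most \<open>\<eta> e < 1\<close> (\<open>norm_row_projector_gap\<close>). Because the ranks agree, the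
same bound holds for \<open>(1 - P) Q\<close> (\<open>projector_gap_swap\<close>), and then for \<open>P - Q\<close>, whose norm is the
distance of the kernels (\<open>kernel_dist_le\<close>).

The representatives of the two solution sets in the definition of the distance are the pseudoinverse
solutions \<open>x\<close> and \<open>y\<close> (\<open>hat_point_sol\<close>). The component \<open>P (y - x) = pinv A (\<Delta>b - \<Delta>A y)\<close> has norm
at most \<open>\<eta> (|\<Delta>b| + e |y|)\<close>, and the component \<open>(1 - P) (y - x) = (1 - P) Q y\<close> has norm at most
\<open>\<eta> e |y|\<close>. By Pythagoras these combine to a bound for \<open>|y - x|\<close> in terms of \<open>|y| \<le> |x| + |y - x|\<close>
(\<open>norm_min_norm_solution_diff_le\<close>). Solving it for \<open>|y - x|\<close> produces the factor
\<open>1 / (1 - sqrt 2 * \<eta> * e)\<close>, and a sum of squares argument the factor \<open>sqrt (2 |x|\<^sup>2 + 1)\<close>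
(\<open>solve_norm_inequality\<close>). The result also dominates \<open>\<eta> e\<close>, so it bounds the distance of the
kernels as well; expanding the fraction by the norm of \<open>A\<close> gives the stated form.

What remains is to justify the notions involved: orthonormal bases exist by Gram-Schmidt, the
projector of a subspace is unique, the Penrose equations have exactly one solution, and the rank,
defined through rows, is the dimension of the range of the row projector
(\<open>dim_range_row_projector\<close>).
\<close>

section \<open>Hermitian products, adjoints and the spectral norm\<close>

lemma hinner_diff_left: "hinner (u - v) w = hinner u w - hinner v w"
  by (simp add: hinner_def sum_subtractf left_diff_distrib)

lemma hinner_scale_left: "hinner (c *s u) w = c * hinner u w"
  by (simp add: hinner_def sum_distrib_left mult.assoc)

lemma hinner_scale_right: "hinner u (c *s w) = cnj c * hinner u w"
  by (simp add: hinner_def sum_distrib_left mult_ac)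

lemma hinner_commute: "hinner v u = cnj (hinner u v)"
  by (simp add: hinner_def mult.commute)

text \<open>
Lengths and real distances only see the real part of the Hermitian product, so the metric arguments
below use the real inner product together with its library; the Hermitian product itself serves to
express adjoints and orthogonality to complex subspaces.
\<close>

lemma inner_eq_Re_hinner: "u \<bullet> v = Re (hinner u v)"
  by (simp add: inner_vec_def hinner_def inner_complex_def)

lemma hinner_self: "hinner u u = of_real ((norm u)\<^sup>2)"
proof -
  have "Im (hinner u u) = 0"
    by (simp add: hinner_def)
  moreover have "Re (hinner u u) = (norm u)\<^sup>2"
    by (simp add: inner_eq_Re_hinner[symmetric] power2_norm_eq_inner)
  ultimately show ?thesis
    by (simp add: complex_eq_iff)
qed

lemma hinner_adjoint: "hinner (A *v u) w = hinner u (hermitian_transpose A *v w)"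
proof -
  have "hinner (A *v u) w = (\<Sum>i\<in>UNIV. \<Sum>j\<in>UNIV. A $ i $ j * u $ j * cnj (w $ i))"
    by (simp add: hinner_def matrix_vector_mult_def sum_distrib_right)
  also have "\<dots> = (\<Sum>j\<in>UNIV. \<Sum>i\<in>UNIV. A $ i $ j * u $ j * cnj (w $ i))"
    by (rule sum.swap)
  also have "\<dots> = hinner u (hermitian_transpose A *v w)"
    by (simp add: hinner_def matrix_vector_mult_def hermitian_transpose_def map_matrix_def
        transpose_def sum_distrib_left mult_ac)
  finally show ?thesis .
qed

lemma hermitian_transpose_mult:
  "hermitian_transpose (A ** B) = hermitian_transpose B ** hermitian_transpose A"
  by (simp add: hermitian_transpose_def map_matrix_def transpose_def vec_eq_iff
      matrix_matrix_mult_def mult.commute)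

lemma hermitian_transpose_diff:
  "hermitian_transpose (A - B) = hermitian_transpose A - hermitian_transpose B"
  by (simp add: hermitian_transpose_def map_matrix_def transpose_def vec_eq_iff)

lemma hermitian_transpose_one [simp]: "hermitian_transpose (mat 1) = mat 1"
  by (auto simp: hermitian_transpose_def map_matrix_def transpose_def vec_eq_iff mat_def)

lemma matrix_diff_ldistrib: "A ** (B - C) = A ** B - A ** (C :: 'a::ring_1^'k^'n)"
  by (simp add: vec_eq_iff matrix_matrix_mult_def right_diff_distrib sum_subtractf)

lemma matrix_diff_rdistrib: "(B - C) ** A = B ** A - (C :: 'a::ring_1^'n^'m) ** A"
  by (simp add: vec_eq_iff matrix_matrix_mult_def left_diff_distrib sum_subtractf)

lemma norm_mult_le_spectral_norm:
  fixes A :: "complex^'n^'m"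
  shows "norm (A *v v) \<le> spectral_norm A * norm v"
  unfolding spectral_norm_def by (rule onorm) simp

lemma spectral_norm_nonneg: "0 \<le> spectral_norm (A :: complex^'n^'m)"
  unfolding spectral_norm_def by (rule onorm_pos_le) simp

lemma spectral_norm_pos:
  fixes A :: "complex^'n^'m"
  assumes "A \<noteq> 0"
  shows "0 < spectral_norm A"
proof -
  from assms have "\<not> (\<forall>v. A *v v = 0)"
    by (metis matrix_eq matrix_vector_mult_0)
  then show ?thesis
    unfolding spectral_norm_def by (simp add: onorm_pos_lt)
qed

section \<open>Orthogonal projectors and their perturbation\<close>

text \<open>
Orthogonal projectors are treated as matrices, and a subspace is represented by the projector onto it:
distances between subspaces are then norms of differences of matrices.
\<close>

definition orth_projector :: "complex^'n^'n \<Rightarrow> bool" where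
  "orth_projector P \<longleftrightarrow> hermitian_transpose P = P \<and> P ** P = P"

lemma orth_projector_idem: "orth_projector P \<Longrightarrow> P *v (P *v v) = P *v v"
  by (simp add: orth_projector_def matrix_vector_mul_assoc)

lemma orth_projector_complement:
  "orth_projector P \<Longrightarrow> orth_projector (mat 1 - P)"
  by (simp add: orth_projector_def hermitian_transpose_diff matrix_diff_ldistrib matrix_diff_rdistrib)

lemma orth_projector_hinner: "orth_projector P \<Longrightarrow> hinner (P *v u) v = hinner u (P *v v)"
  by (simp add: hinner_adjoint orth_projector_def)

lemma orth_projector_inner: "orth_projector P \<Longrightarrow> (P *v u) \<bullet> v = u \<bullet> (P *v v)"
  by (simp add: inner_eq_Re_hinner orth_projector_hinner)

lemma orth_projector_pythagoras:
  assumes "orth_projector P"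
  shows "(norm v)\<^sup>2 = (norm (P *v v))\<^sup>2 + (norm (v - P *v v))\<^sup>2"
proof -
  have "v \<bullet> (P *v v) = (P *v v) \<bullet> (P *v v)"
    using assms by (metis orth_projector_idem orth_projector_inner)
  then show ?thesis
    by (simp add: power2_norm_eq_inner inner_diff_left inner_diff_right inner_commute)
qed

text \<open>
Equal ranges give \<open>P Q = Q\<close> and \<open>Q P = P\<close>; taking adjoints in the first equation turns it
into \<open>Q P = Q\<close>.
\<close>

lemma orth_projector_unique:
  assumes P: "orth_projector P" and Q: "orth_projector Q"
    and range: "range (\<lambda>v. P *v v) = range (\<lambda>v. Q *v v)"
  shows "P = Q"
proof -
  have "P *v (Q *v v) = Q *v v" "Q *v (P *v v) = P *v v" for v
    using P Q range by (metis orth_projector_idem rangeE rangeI)+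
  then have "P ** Q = Q" "Q ** P = P"
    by (auto simp: matrix_eq simp flip: matrix_vector_mul_assoc)
  then show "P = Q"
    using P Q by (metis hermitian_transpose_mult orth_projector_def)
qed

text \<open>
The bound for \<open>P (1 - Q)\<close> is handed over to \<open>(1 - P) Q\<close>. By adjointness every \<open>z\<close> in the range
of \<open>P\<close> lies within \<open>c |z|\<close> of \<open>Q z\<close>. As \<open>c < 1\<close>, \<open>Q\<close> is injective on the range of \<open>P\<close>, and as the
dimensions agree it maps that range onto the range of \<open>Q\<close>. Hence each \<open>y\<close> in the range of \<open>Q\<close> is
\<open>Q z\<close> for some \<open>z\<close> in the range of \<open>P\<close>. The sine of the angle between \<open>y\<close> and \<open>z\<close> is at most \<open>c\<close>,
and it bounds the distance of \<open>y\<close> from the line through \<open>z\<close>, thus from the range of \<open>P\<close>, relative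
to \<open>|y|\<close>.
Both hypotheses are essential: without equality of the dimensions the range of \<open>Q\<close> could contain
vectors orthogonal to the range of \<open>P\<close>, and for \<open>c = 1\<close> nothing is assumed about the two ranges.
\<close>

lemma projector_gap_swap:
  fixes P Q :: "complex^'n^'n"
  assumes P: "orth_projector P" and Q: "orth_projector Q"
    and dim: "vec.dim (range (\<lambda>v. P *v v)) = vec.dim (range (\<lambda>v. Q *v v))"
    and c0: "0 \<le> c" and c: "c < 1" and gap: "\<And>v. norm (P *v (v - Q *v v)) \<le> c * norm v"
  shows "norm (Q *v v - P *v (Q *v v)) \<le> c * norm (Q *v v)"
proof -
  define RP where "RP = range (\<lambda>v. P *v v)"
  define RQ where "RQ = range (\<lambda>v. Q *v v)"
  have sub: "vec.subspace RP" "vec.subspace RQ"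
    unfolding RP_def RQ_def by (simp_all add: vec.subspace_image)
  have fix_P: "P *v z = z" if "z \<in> RP" for z
    using that P by (auto simp: RP_def orth_projector_idem)
  have near: "norm (z - Q *v z) \<le> c * norm z" if z: "z \<in> RP" for z
  proof -
    define r where "r = z - Q *v z"
    have Qr: "Q *v r = 0"
      using Q by (simp add: r_def matrix_vector_mult_diff_distrib orth_projector_idem)
    have "r \<bullet> (Q *v z) = 0"
      by (metis Q Qr inner_zero_left orth_projector_inner)
    then have "(norm r)\<^sup>2 = r \<bullet> z"
      by (simp add: power2_norm_eq_inner r_def inner_diff_right inner_diff_left)
    also have "\<dots> = (P *v r) \<bullet> z"
      using P fix_P[OF z] by (simp add: orth_projector_inner)
    also have "\<dots> \<le> norm (P *v r) * norm z"
      by (rule norm_cauchy_schwarz)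
    also have "\<dots> \<le> (c * norm r) * norm z"
      using gap[of r] Qr by (intro mult_right_mono) auto
    finally have "norm r * norm r \<le> norm r * (c * norm z)"
      by (simp add: power2_eq_square mult_ac)
    then show ?thesis
      unfolding r_def[symmetric] using c0
      by (cases "r = 0") auto
  qed
  have inj: "inj_on (\<lambda>v. Q *v v) RP"
  proof (rule inj_onI)
    fix u w assume "u \<in> RP" "w \<in> RP" and eq: "Q *v u = Q *v w"
    then have "u - w \<in> RP"
      using sub by (simp add: vec.subspace_diff)
    from near[OF this] have "norm (u - w) \<le> c * norm (u - w)"
      by (simp add: matrix_vector_mult_diff_distrib eq)
    then have "(1 - c) * norm (u - w) \<le> 0"
      by (simp add: algebra_simps)
    with c show "u = w"
      by (simp add: mult_le_0_iff)
  qed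
  have "vec.dim ((\<lambda>v. Q *v v) ` RP) = vec.dim RP"
    using inj sub by (intro vec.dim_image_eq) (auto simp: vec.span_eq_iff[THEN iffD2])
  then have onto: "(\<lambda>v. Q *v v) ` RP = RQ"
    using sub dim by (intro vec.subspace_dim_equal) (auto simp: RP_def RQ_def vec.subspace_image)
  define y where "y = Q *v v"
  have "y \<in> RQ"
    by (simp add: y_def RQ_def)
  then obtain z where z: "z \<in> RP" and y: "y = Q *v z"
    using onto by auto
  show ?thesis
  proof (cases "z = 0")
    case True
    then show ?thesis
      using y y_def c0 by simp
  next
    case False
    \<comment> \<open>The multiple \<open>t z\<close> is the point closest to \<open>y\<close> on the line through \<open>z\<close>.\<close>
    define t where "t = (norm y)\<^sup>2 / (norm z)\<^sup>2"
    have yz: "y \<bullet> z = (norm y)\<^sup>2"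
      using Q by (metis y orth_projector_idem orth_projector_inner power2_norm_eq_inner)
    have py: "(norm z)\<^sup>2 = (norm y)\<^sup>2 + (norm (z - y))\<^sup>2"
      using orth_projector_pythagoras[OF Q, of z] y by simp
    have le: "(norm (z - y))\<^sup>2 \<le> c\<^sup>2 * (norm z)\<^sup>2"
      using near[OF z] y by (metis norm_ge_zero power_mono power_mult_distrib)
    have ratio: "1 - t \<le> c\<^sup>2"
    proof -
      have "1 - t = (norm (z - y))\<^sup>2 / (norm z)\<^sup>2"
        unfolding t_def using False py by (simp add: diff_divide_eq_iff)
      with le False show ?thesis
        by (simp add: divide_le_eq)
    qed
    have "P *v (t *\<^sub>R z) = t *\<^sub>R z"
      using fix_P[OF z] by (simp add: linear_cmul)
    then have split: "y - t *\<^sub>R z - P *v (y - t *\<^sub>R z) = y - P *v y"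
      by (simp add: matrix_vector_mult_diff_distrib)
    have "(norm (y - P *v y))\<^sup>2 \<le> (norm (y - t *\<^sub>R z))\<^sup>2"
      using orth_projector_pythagoras[OF P, of "y - t *\<^sub>R z"] split by simp
    also have "\<dots> = (norm y)\<^sup>2 - 2 * t * (norm y)\<^sup>2 + t * (t * (norm z)\<^sup>2)"
      using yz by (simp add: power2_norm_eq_inner inner_diff_left inner_diff_right inner_commute algebra_simps)
    also have "t * (norm z)\<^sup>2 = (norm y)\<^sup>2"
      using False by (simp add: t_def)
    also have "(norm y)\<^sup>2 - 2 * t * (norm y)\<^sup>2 + t * (norm y)\<^sup>2 = (1 - t) * (norm y)\<^sup>2"
      by (simp add: algebra_simps)
    also have "\<dots> \<le> c\<^sup>2 * (norm y)\<^sup>2"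
      using ratio by (intro mult_right_mono) auto
    finally have "(norm (y - P *v y))\<^sup>2 \<le> (c * norm y)\<^sup>2"
      by (simp add: power_mult_distrib)
    then show ?thesis
      unfolding y_def[symmetric] using c0 by (auto elim: power2_le_imp_le)
  qed
qed

text \<open>
In \<open>P - Q = P (1 - Q) - (1 - P) Q\<close> the two terms have orthogonal values, and they only see the
orthogonal components \<open>(1 - Q) v\<close> and \<open>Q v\<close> of the argument; so their bounds do not add up.
\<close>

lemma spectral_norm_projector_diff_le:
  fixes P Q :: "complex^'n^'n"
  assumes P: "orth_projector P" and Q: "orth_projector Q"
    and dim: "vec.dim (range (\<lambda>v. P *v v)) = vec.dim (range (\<lambda>v. Q *v v))"
    and c: "0 \<le> c" "c < 1" and gap: "\<And>v. norm (P *v (v - Q *v v)) \<le> c * norm v"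
  shows "spectral_norm (P - Q) \<le> c"
  unfolding spectral_norm_def
proof (rule onorm_le)
  fix v
  define p where "p = P *v (v - Q *v v)"
  define q where "q = Q *v v - P *v (Q *v v)"
  have "p = P *v (v - Q *v v - Q *v (v - Q *v v))"
    using Q by (simp add: p_def matrix_vector_mult_diff_distrib orth_projector_idem)
  then have "norm p \<le> c * norm (v - Q *v v)"
    using gap[of "v - Q *v v"] by simp
  moreover have "norm q \<le> c * norm (Q *v v)"
    unfolding q_def using projector_gap_swap[OF P Q dim c gap] .
  ultimately have pq: "(norm p)\<^sup>2 + (norm q)\<^sup>2
      \<le> (c * norm (v - Q *v v))\<^sup>2 + (c * norm (Q *v v))\<^sup>2"
    by (intro add_mono power_mono) auto
  define w where "w = (P - Q) *v v"
  have w: "P *v w = p" "w - P *v w = - q"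
    using P by (simp_all add: w_def p_def q_def matrix_vector_mult_diff_rdistrib
        matrix_vector_mult_diff_distrib orth_projector_idem)
  have "(norm w)\<^sup>2 = (norm p)\<^sup>2 + (norm q)\<^sup>2"
    using orth_projector_pythagoras[OF P, of w] unfolding w(2) unfolding w(1) by simp
  also have "\<dots> \<le> (c * norm v)\<^sup>2"
    unfolding power_mult_distrib orth_projector_pythagoras[OF Q, of v]
    using pq by (simp add: power_mult_distrib distrib_left)
  finally show "norm ((P - Q) *v v) \<le> c * norm v"
    unfolding w_def[symmetric] using c by (auto elim: power2_le_imp_le)
qed

section \<open>Orthonormal bases and the distance between subspaces\<close>

lemma column_gram_mult: "column_gram B *v x = (\<Sum>v\<in>B. hinner x v *s v)"
proof -
  have "(column_gram B *v x) $ i = (\<Sum>v\<in>B. hinner x v *s v) $ i" for i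
  proof -
    have "(column_gram B *v x) $ i = (\<Sum>j\<in>UNIV. \<Sum>v\<in>B. x $ j * cnj (v $ j) * v $ i)"
      by (simp add: column_gram_def matrix_vector_mult_def sum_distrib_left mult_ac)
    also have "\<dots> = (\<Sum>v\<in>B. \<Sum>j\<in>UNIV. x $ j * cnj (v $ j) * v $ i)"
      by (rule sum.swap)
    also have "\<dots> = (\<Sum>v\<in>B. hinner x v *s v) $ i"
      by (simp add: hinner_def sum_distrib_right)
    finally show ?thesis .
  qed
  then show ?thesis
    by (simp add: vec_eq_iff)
qed

lemma column_gram_fixes_span:
  assumes "orthonormal_basis B V" "v \<in> V"
  shows "column_gram B *v v = v"
proof -
  have basis: "column_gram B *v b = b" if "b \<in> B" for b
  proof -
    have "column_gram B *v b = (\<Sum>v\<in>B. if v = b then b else 0)"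
      unfolding column_gram_mult using assms(1) that
      by (intro sum.cong) (auto simp: orthonormal_basis_def)
    then show ?thesis
      using assms(1) that by (simp add: orthonormal_basis_def)
  qed
  have "v \<in> vec.span B"
    using assms by (simp add: orthonormal_basis_def)
  then show ?thesis
    by (induction rule: vec.span_induct_alt)
      (simp_all add: vec.add vec.scale basis)
qed

lemma range_column_gram:
  assumes "orthonormal_basis B V"
  shows "range (\<lambda>v. column_gram B *v v) = V"
proof (intro subset_antisym subsetI)
  fix y assume "y \<in> range (\<lambda>v. column_gram B *v v)"
  then have "y \<in> vec.span B"
    unfolding column_gram_mult
    by (elim rangeE) (simp, rule vec.span_sum, rule vec.span_scale, rule vec.span_base)
  then show "y \<in> V"
    using assms by (simp add: orthonormal_basis_def)
next
  fix y assume "y \<in> V"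
  then show "y \<in> range (\<lambda>v. column_gram B *v v)"
    using column_gram_fixes_span[OF assms] by (metis rangeI)
qed

lemma orth_projector_column_gram:
  assumes "orthonormal_basis B V"
  shows "orth_projector (column_gram B)"
proof -
  have "column_gram B ** column_gram B = column_gram B"
    unfolding matrix_eq matrix_vector_mul_assoc[symmetric]
    using assms by (metis column_gram_fixes_span range_column_gram rangeI)
  moreover have "hermitian_transpose (column_gram B) = column_gram B"
    by (simp add: hermitian_transpose_def map_matrix_def transpose_def column_gram_def vec_eq_iff
        mult.commute)
  ultimately show ?thesis
    by (simp add: orth_projector_def)
qed

text \<open>
One step of the Gram-Schmidt process.
\<close>

lemma orthonormal_basis_insert:
  assumes B: "orthonormal_basis B (vec.span S)"
  shows "\<exists>C. orthonormal_basis C (vec.span (insert a S))"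
proof -
  define r where "r = a - column_gram B *v a"
  have B_ortho: "finite B" "vec.span B = vec.span S"
    "\<And>u v. u \<in> B \<Longrightarrow> v \<in> B \<Longrightarrow> hinner u v = (if u = v then 1 else 0)"
    using B by (auto simp: orthonormal_basis_def)
  have proj: "column_gram B *v a \<in> vec.span S"
    using range_column_gram[OF B] by auto
  show ?thesis
  proof (cases "r = 0")
    case True
    then have "a \<in> vec.span S"
      using proj by (simp add: r_def)
    then show ?thesis
      using B by (metis vec.span_redundant)
  next
    case False
    have r_orth: "hinner r b = 0" if "b \<in> B" for b
    proof -
      have "hinner (column_gram B *v a) b = hinner a (column_gram B *v b)"
        by (rule orth_projector_hinner[OF orth_projector_column_gram[OF B]])
      also have "column_gram B *v b = b"
        using that B_ortho(2) by (intro column_gram_fixes_span[OF B]) (metis vec.span_base)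
      finally show ?thesis
        by (simp add: r_def hinner_diff_left)
    qed
    define k where "k = complex_of_real (inverse (norm r))"
    define e where "e = k *s r"
    have k: "k \<noteq> 0" "k * cnj k * of_real ((norm r)\<^sup>2) = 1"
      using False by (simp_all add: k_def power2_eq_square field_simps)
    have ee: "hinner e e = 1"
      using k(2) unfolding e_def hinner_scale_left hinner_scale_right
      unfolding hinner_self by (simp add: mult_ac)
    have eb: "hinner e b = 0" "hinner b e = 0" if "b \<in> B" for b
    proof -
      show "hinner e b = 0"
        using r_orth[OF that] by (simp add: e_def hinner_scale_left)
      then show "hinner b e = 0"
        using hinner_commute[of b e] by simp
    qed
    have span: "vec.span (insert e B) = vec.span (insert a S)"
    proof (rule vec.span_eq[THEN iffD2], intro conjI)
      have "r \<in> vec.span (insert a S)"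
        unfolding r_def using proj vec.span_mono[of S "insert a S"]
        by (intro vec.span_diff) (auto intro: vec.span_base)
      moreover have "B \<subseteq> vec.span (insert a S)"
        using vec.span_superset[of B] B_ortho(2) vec.span_mono[of S "insert a S"] by auto
      ultimately show "insert e B \<subseteq> vec.span (insert a S)"
        by (auto simp: e_def intro: vec.span_scale)
      have "r = inverse k *s e"
        using k(1) by (simp add: e_def)
      then have "r \<in> vec.span (insert e B)"
        by (metis insertI1 vec.span_base vec.span_scale)
      moreover have S: "vec.span S \<subseteq> vec.span (insert e B)"
        unfolding B_ortho(2)[symmetric] by (rule vec.span_mono) auto
      moreover have "a = r + column_gram B *v a"
        by (simp add: r_def)
      ultimately have "a \<in> vec.span (insert e B)"
        using proj by (metis subsetD vec.span_add)
      then show "insert a S \<subseteq> vec.span (insert e B)"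
        using S vec.span_superset[of S] by auto
    qed
    have "orthonormal_basis (insert e B) (vec.span (insert a S))"
      unfolding orthonormal_basis_def
    proof (intro conjI ballI)
      fix u v assume "u \<in> insert e B" "v \<in> insert e B"
      then show "hinner u v = (if u = v then 1 else 0)"
        using B_ortho(3) eb ee by (metis insertE)
    qed (use B_ortho(1) span in auto)
    then show ?thesis ..
  qed
qed

lemma orthonormal_basis_exists:
  fixes V :: "(complex^'n) set"
  assumes "vec.subspace V"
  shows "\<exists>B. orthonormal_basis B V"
proof -
  obtain S where S: "S \<subseteq> V" "vec.independent S" "V \<subseteq> vec.span S"
    using vec.basis_exists[of V] by metis
  have "finite S"
    using S(2) by (rule vec.finiteI_independent)
  then have "\<exists>B. orthonormal_basis B (vec.span S)"
  proof (induction S)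
    case empty
    have "orthonormal_basis {} (vec.span {} :: (complex^'n) set)"
      by (simp add: orthonormal_basis_def)
    then show ?case ..
  next
    case (insert a S)
    then show ?case
      using orthonormal_basis_insert by blast
  qed
  moreover have "vec.span S = V"
    using S assms by (metis subset_antisym vec.span_minimal)
  ultimately show ?thesis
    by simp
qed

lemma orth_projector_exists:
  fixes V :: "(complex^'n) set"
  assumes "vec.subspace V"
  obtains P where "orth_projector P" "range (\<lambda>v. P *v v) = V"
  using orthonormal_basis_exists[OF assms] orth_projector_column_gram range_column_gram by blast

text \<open>
Every orthonormal basis of a subspace yields the same matrix \<^const>\<open>column_gram\<close>, namely the unique
orthogonal projector onto it; this makes the distance well defined and computable from any projectors.
\<close>

lemma subspace_dist_eq:
  fixes P Q :: "complex^'n^'n"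
  assumes P: "orth_projector P" and Q: "orth_projector Q"
  shows "subspace_dist (range (\<lambda>v. P *v v)) (range (\<lambda>v. Q *v v)) = spectral_norm (P - Q)"
    (is "subspace_dist ?V ?W = _")
proof -
  have gram: "column_gram B = R" if "orthonormal_basis B (range (\<lambda>v. R *v v))" "orth_projector R"
    for B and R :: "complex^'n^'n"
    using that by (intro orth_projector_unique) (simp_all add: orth_projector_column_gram range_column_gram)
  obtain B C where "orthonormal_basis B ?V" "orthonormal_basis C ?W"
    using orthonormal_basis_exists[OF vec.subspace_image[OF vec.subspace_UNIV]] by metis
  then show ?thesis
    unfolding subspace_dist_def using gram P Q by (intro the_equality) blast+
qed

section \<open>The Moore-Penrose inverse and the projector onto the row space\<close>

text \<open>
For two candidates \<open>X\<close> and \<open>Y\<close>, the products \<open>A X\<close> and \<open>A Y\<close> are Hermitian and \<open>A Y A X = A X\<close>;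
taking adjoints shows that they coincide, and likewise \<open>X A = Y A\<close>. Then \<open>X = X A X = Y A Y = Y\<close>.
\<close>

lemma is_moore_penrose_unique:
  assumes X: "is_moore_penrose A X" and Y: "is_moore_penrose A Y"
  shows "X = Y"
proof -
  note x = X[unfolded is_moore_penrose_def] and y = Y[unfolded is_moore_penrose_def]
  have "A ** X = hermitian_transpose (A ** Y ** (A ** X))"
    using x y by (metis matrix_mul_assoc)
  also have "\<dots> = A ** X ** (A ** Y)"
    using x y by (simp add: hermitian_transpose_mult[of "A ** Y"])
  also have "\<dots> = A ** Y"
    using x by (simp add: matrix_mul_assoc)
  finally have AX: "A ** X = A ** Y" .
  have "X ** A = hermitian_transpose (X ** A ** (Y ** A))"
    using x y by (metis matrix_mul_assoc)
  also have "\<dots> = Y ** A ** (X ** A)"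
    using x y by (simp add: hermitian_transpose_mult[of "X ** A"])
  also have "\<dots> = Y ** A"
    using x by (metis matrix_mul_assoc)
  finally have XA: "X ** A = Y ** A" .
  have "X = X ** A ** X"
    using x by simp
  also have "\<dots> = Y ** A ** Y"
    using AX XA by (metis matrix_mul_assoc)
  finally show ?thesis
    using y by simp
qed

text \<open>
Let \<open>G\<close> be any matrix that picks preimages on the range of \<open>A\<close>, let \<open>R\<close> project onto that range,
and let \<open>P\<close> project onto the orthogonal complement of the kernel. In \<open>P G R\<close> the factor \<open>R\<close>
discards what \<open>A\<close> cannot reach, and \<open>P\<close> removes the ambiguity of the preimage; then
\<open>A (P G R) = R\<close> and \<open>(P G R) A = P\<close> are Hermitian.
\<close>

lemma is_moore_penrose_exists:
  fixes A :: "complex^'n^'m"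
  shows "\<exists>X. is_moore_penrose A X"
proof -
  obtain g where g: "Vector_Spaces.linear (*s) (*s) g" "\<And>u. A *v g (A *v u) = A *v u"
    using vec.linear_exists_right_inverse_on[OF matrix_vector_mul_linear_gen[of A] vec.subspace_UNIV]
    by blast
  define G where "G = matrix g"
  have AGA: "A ** G ** A = A"
    unfolding matrix_eq matrix_vector_mul_assoc[symmetric] G_def by (simp add: matrix_works g)
  obtain N where N: "orth_projector N" "range (\<lambda>v. N *v v) = {v. A *v v = 0}"
    using orth_projector_exists[OF vec.subspace_kernel] by blast
  obtain R where R: "orth_projector R" "range (\<lambda>v. R *v v) = range (\<lambda>u. A *v u)"
    using orth_projector_exists[OF vec.subspace_image[OF vec.subspace_UNIV]] by blast
  define P where "P = mat 1 - N"
  define X where "X = P ** G ** R"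
  have P: "orth_projector P"
    unfolding P_def using N(1) by (rule orth_projector_complement)
  have "A *v (N *v v) = 0" for v
    using N(2) by blast
  then have AP: "A ** P = A"
    unfolding matrix_eq matrix_vector_mul_assoc[symmetric]
    by (simp add: P_def matrix_vector_mult_diff_rdistrib matrix_vector_mult_diff_distrib)
  have "R *v (A *v u) = A *v u" for u
    using R by (metis orth_projector_idem rangeE rangeI)
  then have RA: "R ** A = A"
    unfolding matrix_eq matrix_vector_mul_assoc[symmetric] by simp
  have AX: "A ** X = R"
  proof -
    have "A *v (G *v (R *v v)) = R *v v" for v
    proof -
      obtain u where u: "R *v v = A *v u"
        using R(2) by blast
      show ?thesis
        unfolding u using AGA by (simp add: matrix_vector_mul_assoc matrix_mul_assoc)
    qed
    then have "A ** G ** R = R"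
      unfolding matrix_eq matrix_vector_mul_assoc[symmetric] by simp
    then show ?thesis
      using AP by (simp add: X_def matrix_mul_assoc)
  qed
  have XA: "X ** A = P"
  proof -
    have "P *v (G *v (A *v v)) = P *v v" for v
    proof -
      have "A *v (G *v (A *v v) - v) = 0"
        using AGA by (simp add: matrix_vector_mult_diff_distrib matrix_vector_mul_assoc matrix_mul_assoc)
      then obtain w where w: "G *v (A *v v) - v = N *v w"
        using N(2) by blast
      have "P *v (N *v w) = 0"
        using N(1) by (simp add: P_def matrix_vector_mult_diff_rdistrib orth_projector_idem)
      then show ?thesis
        unfolding w[symmetric] by (simp add: matrix_vector_mult_diff_distrib)
    qed
    then have "P ** G ** A = P"
      unfolding matrix_eq matrix_vector_mul_assoc[symmetric] by simp
    then show ?thesis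
      using RA by (metis X_def matrix_mul_assoc)
  qed
  have "P ** X = X"
    using P by (simp add: X_def matrix_mul_assoc orth_projector_def)
  then have "is_moore_penrose A X"
    using AX XA RA P R(1) by (simp add: is_moore_penrose_def orth_projector_def)
  then show ?thesis ..
qed

lemma pinv_moore_penrose: "is_moore_penrose A (pinv A)"
  unfolding pinv_def using is_moore_penrose_exists is_moore_penrose_unique by (metis theI)

text \<open>
The orthogonal projector onto the orthogonal complement of the kernel, which is the complex conjugate
of the row space.
\<close>

definition row_projector :: "complex^'n^'m \<Rightarrow> complex^'n^'n" where
  "row_projector A = pinv A ** A"

lemma row_projector_facts:
  shows orth_projector_row_projector: "orth_projector (row_projector A)"
    and mult_row_projector: "A ** row_projector A = A"
    and row_projector_pinv: "row_projector A ** pinv A = pinv A"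
  using pinv_moore_penrose[of A]
  by (simp_all add: is_moore_penrose_def orth_projector_def row_projector_def matrix_mul_assoc)

lemma range_row_projector_complement:
  "range (\<lambda>v. (mat 1 - row_projector A) *v v) = {v. A *v v = 0}"
proof (intro subset_antisym subsetI)
  fix y assume "y \<in> range (\<lambda>v. (mat 1 - row_projector A) *v v)"
  then show "y \<in> {v. A *v v = 0}"
    by (auto simp: matrix_vector_mul_assoc matrix_diff_ldistrib mult_row_projector)
next
  fix y assume "y \<in> {v. A *v v = 0}"
  then have "(mat 1 - row_projector A) *v y = y"
    by (simp add: row_projector_def matrix_vector_mult_diff_rdistrib flip: matrix_vector_mul_assoc)
  then show "y \<in> range (\<lambda>v. (mat 1 - row_projector A) *v v)"
    by (metis rangeI)
qed

definition conj_vec :: "complex^'n \<Rightarrow> complex^'n" where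
  "conj_vec v = (\<chi> i. cnj (v $ i))"

lemma conj_vec_involutive [simp]: "conj_vec (conj_vec v) = v"
  by (simp add: conj_vec_def vec_eq_iff)

text \<open>
Conjugation is only semilinear, so its effect on complex dimension is derived from spanning sets
rather than from the theory of linear maps.
\<close>

lemma dim_conj_image: "vec.dim (conj_vec ` V) = vec.dim V"
proof -
  have le: "vec.dim (conj_vec ` V) \<le> vec.dim V" for V :: "(complex^'n) set"
  proof -
    obtain B where B: "vec.independent B" "V \<subseteq> vec.span B" "card B = vec.dim V"
      using vec.basis_exists[of V] by metis
    then have fin: "finite B"
      using vec.finiteI_independent by blast
    have "conj_vec v \<in> vec.span (conj_vec ` B)" if "v \<in> vec.span B" for v
      using that
    proof (induction rule: vec.span_induct_alt)
      case base
      have "conj_vec 0 = (0 :: complex^'n)"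
        by (simp add: conj_vec_def vec_eq_iff)
      then show ?case
        by (simp add: vec.span_zero)
    next
      case (step c x y)
      have "conj_vec (c *s x + y) = cnj c *s conj_vec x + conj_vec y"
        by (simp add: conj_vec_def vec_eq_iff)
      with step show ?case
        by (metis image_eqI vec.span_add vec.span_base vec.span_scale)
    qed
    then have "vec.dim (conj_vec ` V) \<le> card (conj_vec ` B)"
      using B(2) fin by (intro vec.dim_le_card) auto
    also have "\<dots> \<le> vec.dim V"
      using fin B(3) card_image_le by metis
    finally show ?thesis .
  qed
  \<comment> \<open>Conjugation is an involution, so the inequality for the conjugate of \<open>V\<close> is the reverse one.\<close>
  have "vec.dim (conj_vec ` conj_vec ` V) \<le> vec.dim (conj_vec ` V)"
    by (rule le)
  with le[of V] show ?thesis
    by (simp add: image_image)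
qed

text \<open>
The rank is the dimension of the row space, while the projector has the range of the conjugate
transpose. The two spaces are complex conjugates of each other and so have the same dimension.
\<close>

lemma dim_range_row_projector:
  "vec.dim (range (\<lambda>v. row_projector A *v v)) = rank A"
proof -
  have conj: "hermitian_transpose A *v v = conj_vec (transpose A *v conj_vec v)" for v
    by (simp add: conj_vec_def hermitian_transpose_def map_matrix_def transpose_def
        matrix_vector_mult_def vec_eq_iff)
  have "range (\<lambda>v. row_projector A *v v) = range (\<lambda>v. hermitian_transpose A *v v)"
  proof (intro subset_antisym image_subsetI)
    fix v
    have "row_projector A = hermitian_transpose A ** hermitian_transpose (pinv A)"
      using orth_projector_row_projector[of A]
      by (metis hermitian_transpose_mult orth_projector_def row_projector_def)
    then show "row_projector A *v v \<in> range (\<lambda>v. hermitian_transpose A *v v)"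
      by (metis matrix_vector_mul_assoc rangeI)
  next
    fix v
    have "hermitian_transpose A = row_projector A ** hermitian_transpose A"
      using orth_projector_row_projector[of A] mult_row_projector[of A]
      by (metis hermitian_transpose_mult orth_projector_def)
    then show "hermitian_transpose A *v v \<in> range (\<lambda>v. row_projector A *v v)"
      by (metis matrix_vector_mul_assoc rangeI)
  qed
  also have "\<dots> = conj_vec ` range (\<lambda>v. transpose A *v v)"
    unfolding conj image_image by (metis conj_vec_involutive surjI image_image)
  also have "vec.dim \<dots> = vec.dim (range (\<lambda>v. transpose A *v v))"
    by (rule dim_conj_image)
  also have "range (\<lambda>v. transpose A *v v) = vec.span (rows A)"
  proof (intro subset_antisym)
    show "range (\<lambda>v. transpose A *v v) \<subseteq> vec.span (rows A)"
      using matrix_vector_mult_in_columnspace_gen[of "transpose A"] by (auto simp: columns_transpose)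
    have "column i (transpose A) \<in> range (\<lambda>v. transpose A *v v)" for i
    proof
      show "column i (transpose A) = transpose A *v axis i 1"
        by (simp add: vec_eq_iff column_def matrix_vector_mult_def axis_def if_distrib cong: if_cong)
    qed simp
    then show "vec.span (rows A) \<subseteq> range (\<lambda>v. transpose A *v v)"
      by (intro vec.span_minimal vec.subspace_image vec.subspace_UNIV)
        (auto simp: columns_transpose[symmetric] columns_def)
  qed
  finally show ?thesis
    by (simp add: row_rank_def_gen)
qed

section \<open>Solution sets as affine subspaces\<close>

lemma direction_sol:
  assumes "d \<in> range (\<lambda>u. G *v u)"
  shows "direction (sol G d) = {v. G *v v = 0}"
proof (intro subset_antisym subsetI)
  fix y assume "y \<in> direction (sol G d)"
  then show "y \<in> {v. G *v v = 0}"
    by (auto simp: direction_def sol_def matrix_vector_mult_diff_distrib)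
next
  fix y assume y: "y \<in> {v. G *v v = 0}"
  obtain u where u: "G *v u = d"
    using assms by auto
  have "y = (u + y) - u" "u + y \<in> sol G d" "u \<in> sol G d"
    using y u by (simp_all add: sol_def matrix_vector_right_distrib)
  then show "y \<in> direction (sol G d)"
    unfolding direction_def by blast
qed

lemma mult_pinv_mult:
  assumes "d \<in> range (\<lambda>u. G *v u)"
  shows "G *v (pinv G *v d) = d"
  using assms pinv_moore_penrose[of G] by (auto simp: matrix_vector_mul_assoc is_moore_penrose_def)

text \<open>
The pseudoinverse solution lies in the range of the row projector, which is orthogonal to the kernel;
two solutions orthogonal to the kernel differ by a kernel vector that is orthogonal to itself.
\<close>

lemma hat_point_sol:
  assumes "d \<in> range (\<lambda>u. G *v u)"
  shows "hat_point (sol G d) = pinv G *v d"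
  unfolding hat_point_def direction_sol[OF assms]
proof (rule the_equality)
  have "hinner (pinv G *v d) v = 0" if "G *v v = 0" for v
  proof -
    have "hinner (pinv G *v d) v = hinner (row_projector G *v (pinv G *v d)) v"
      by (simp add: matrix_vector_mul_assoc row_projector_pinv)
    also have "\<dots> = hinner (pinv G *v d) (row_projector G *v v)"
      by (rule orth_projector_hinner[OF orth_projector_row_projector])
    also have "row_projector G *v v = 0"
      by (simp add: row_projector_def that flip: matrix_vector_mul_assoc)
    finally show ?thesis
      by (simp add: hinner_def)
  qed
  then show min: "pinv G *v d \<in> sol G d \<and> (\<forall>v\<in>{v. G *v v = 0}. hinner (pinv G *v d) v = 0)"
    using mult_pinv_mult[OF assms] by (simp add: sol_def)
  fix y assume y: "y \<in> sol G d \<and> (\<forall>v\<in>{v. G *v v = 0}. hinner y v = 0)"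
  have "G *v (y - pinv G *v d) = 0"
    using y min by (simp add: sol_def matrix_vector_mult_diff_distrib)
  then have "hinner (y - pinv G *v d) (y - pinv G *v d) = 0"
    using y min by (subst hinner_diff_left) simp
  then show "y = pinv G *v d"
    by (simp add: hinner_self)
qed

section \<open>Perturbation of the solution set\<close>

text \<open>
On the kernel of \<open>B\<close> the matrix \<open>A\<close> acts as \<open>A - B\<close>, and \<open>w = v - row_projector B *v v\<close> lies in
that kernel; so the row projector of \<open>A\<close> sends \<open>w\<close> to \<open>pinv A *v ((A - B) *v w)\<close>.
\<close>

lemma norm_row_projector_gap:
  "norm (row_projector A *v (v - row_projector B *v v))
    \<le> spectral_norm (pinv A) * spectral_norm (B - A) * norm v"
proof -
  define w where "w = v - row_projector B *v v"
  have "B *v w = 0"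
    by (simp add: w_def matrix_vector_mult_diff_distrib matrix_vector_mul_assoc mult_row_projector)
  then have "A *v w = - ((B - A) *v w)"
    by (simp add: matrix_vector_mult_diff_rdistrib)
  then have "norm (row_projector A *v w) = norm (pinv A *v ((B - A) *v w))"
    by (simp add: row_projector_def vec.neg flip: matrix_vector_mul_assoc)
  also have "\<dots> \<le> spectral_norm (pinv A) * norm ((B - A) *v w)"
    by (rule norm_mult_le_spectral_norm)
  also have "\<dots> \<le> spectral_norm (pinv A) * (spectral_norm (B - A) * norm v)"
  proof (intro mult_left_mono spectral_norm_nonneg)
    have "(norm w)\<^sup>2 \<le> (norm v)\<^sup>2"
      using orth_projector_pythagoras[OF orth_projector_row_projector[of B], of v]
      by (simp add: w_def)
    then have "norm w \<le> norm v"
      by (rule power2_le_imp_le) simp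
    then show "norm ((B - A) *v w) \<le> spectral_norm (B - A) * norm v"
      by (meson norm_mult_le_spectral_norm mult_left_mono order_trans spectral_norm_nonneg)
  qed
  finally show ?thesis
    by (simp add: w_def mult.assoc)
qed

text \<open>
The quantities stand for \<open>D = |y - x|\<close>, \<open>t = |y|\<close>, \<open>s = |x|\<close>, where \<open>x\<close> and \<open>y\<close> are the
minimum norm solutions, and for the sizes \<open>e\<close> and \<open>d\<close> of the perturbations. Replacing \<open>t\<close> by
\<open>s + D\<close> and separating the multiples of \<open>D\<close> by the triangle inequality in the plane leaves the
vector \<open>(\<eta> e D, \<eta> e D)\<close>, whose length \<open>sqrt 2 * \<eta> * e * D\<close> is absorbed on the left.
This is where the factor \<open>sqrt 2\<close> in the smallness condition comes from.
\<close>

lemma solve_norm_inequality: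
  fixes D s t e d \<eta> :: real
  assumes nonneg: "0 \<le> D" "0 \<le> e" "0 \<le> d" "0 \<le> \<eta>" "0 \<le> t"
    and t: "t \<le> s + D" and small: "sqrt 2 * \<eta> * e < 1"
    and D: "D\<^sup>2 \<le> (\<eta> * (d + e * t))\<^sup>2 + (\<eta> * e * t)\<^sup>2"
  shows "D \<le> \<eta> * sqrt (2 * s\<^sup>2 + 1) / (1 - sqrt 2 * \<eta> * e) * sqrt (e\<^sup>2 + d\<^sup>2)"
proof -
  have "D \<le> sqrt ((\<eta> * (d + e * t))\<^sup>2 + (\<eta> * e * t)\<^sup>2)"
    using D by (rule real_le_rsqrt)
  also have "\<dots> \<le> sqrt ((\<eta> * (d + e * s) + \<eta> * e * D)\<^sup>2 + (\<eta> * e * s + \<eta> * e * D)\<^sup>2)"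
  proof (intro real_sqrt_le_mono add_mono power_mono)
    have "\<eta> * e * t \<le> \<eta> * e * (s + D)"
      using t nonneg by (intro mult_left_mono) auto
    then show "\<eta> * (d + e * t) \<le> \<eta> * (d + e * s) + \<eta> * e * D" "\<eta> * e * t \<le> \<eta> * e * s + \<eta> * e * D"
      by (simp_all add: algebra_simps)
  qed (use nonneg in auto)
  also have "\<dots> \<le> sqrt ((\<eta> * (d + e * s))\<^sup>2 + (\<eta> * e * s)\<^sup>2) + sqrt ((\<eta> * e * D)\<^sup>2 + (\<eta> * e * D)\<^sup>2)"
    by (rule real_sqrt_sum_squares_triangle_ineq)
  also have "sqrt ((\<eta> * e * D)\<^sup>2 + (\<eta> * e * D)\<^sup>2) = sqrt 2 * \<eta> * e * D"
  proof -
    have "(\<eta> * e * D)\<^sup>2 + (\<eta> * e * D)\<^sup>2 = 2 * (\<eta> * e * D)\<^sup>2"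
      by simp
    then show ?thesis
      using nonneg by (simp add: real_sqrt_mult)
  qed
  also have "sqrt ((\<eta> * (d + e * s))\<^sup>2 + (\<eta> * e * s)\<^sup>2) \<le> \<eta> * (sqrt (2 * s\<^sup>2 + 1) * sqrt (e\<^sup>2 + d\<^sup>2))"
  proof -
    \<comment> \<open>This sum of squares is the exact gap in the inequality that follows.\<close>
    have "0 \<le> (e - s * d)\<^sup>2 + (s * d)\<^sup>2"
      by simp
    then have "(d + e * s)\<^sup>2 + (e * s)\<^sup>2 \<le> (2 * s\<^sup>2 + 1) * (e\<^sup>2 + d\<^sup>2)"
      by (simp add: power2_eq_square algebra_simps)
    then have "\<eta>\<^sup>2 * ((d + e * s)\<^sup>2 + (e * s)\<^sup>2) \<le> \<eta>\<^sup>2 * ((2 * s\<^sup>2 + 1) * (e\<^sup>2 + d\<^sup>2))"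
      by (intro mult_left_mono) auto
    then have "(\<eta> * (d + e * s))\<^sup>2 + (\<eta> * e * s)\<^sup>2 \<le> \<eta>\<^sup>2 * ((2 * s\<^sup>2 + 1) * (e\<^sup>2 + d\<^sup>2))"
      by (simp only: power_mult_distrib distrib_left[of "\<eta>\<^sup>2" "(d + e * s)\<^sup>2"] mult.assoc)
    then have "sqrt ((\<eta> * (d + e * s))\<^sup>2 + (\<eta> * e * s)\<^sup>2) \<le> sqrt (\<eta>\<^sup>2 * ((2 * s\<^sup>2 + 1) * (e\<^sup>2 + d\<^sup>2)))"
      by (rule real_sqrt_le_mono)
    then show ?thesis
      using nonneg by (simp add: real_sqrt_mult)
  qed
  finally have "D * (1 - sqrt 2 * \<eta> * e) \<le> \<eta> * (sqrt (2 * s\<^sup>2 + 1) * sqrt (e\<^sup>2 + d\<^sup>2))"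
    by (simp add: algebra_simps)
  then have "D \<le> \<eta> * (sqrt (2 * s\<^sup>2 + 1) * sqrt (e\<^sup>2 + d\<^sup>2)) / (1 - sqrt 2 * \<eta> * e)"
    using small by (simp add: pos_le_divide_eq)
  then show ?thesis
    by (simp add: mult.assoc)
qed

text \<open>
The difference of the solutions is split along the row projector of \<open>A\<close>. The row component is
determined by the residual \<open>A (y - x) = \<Delta>b - \<Delta>A y\<close>. In the kernel of \<open>A\<close>, where \<open>x\<close> has no
component, only \<open>y\<close> contributes, and \<open>y\<close> lies in the range of the perturbed row projector, which
is almost orthogonal to that kernel.
\<close>

lemma norm_min_norm_solution_diff_le:
  fixes A \<Delta>A :: "complex^'n^'m" and b \<Delta>b :: "complex^'m"
  assumes b: "b \<in> range (\<lambda>u. A *v u)"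
    and rank: "rank (A + \<Delta>A) = rank A"
    and bt: "b + \<Delta>b \<in> range (\<lambda>u. (A + \<Delta>A) *v u)"
    and c: "spectral_norm (pinv A) * spectral_norm \<Delta>A < 1"
    and x: "x = pinv A *v b" and y: "y = pinv (A + \<Delta>A) *v (b + \<Delta>b)"
  shows "(norm (y - x))\<^sup>2
    \<le> (spectral_norm (pinv A) * (norm \<Delta>b + spectral_norm \<Delta>A * norm y))\<^sup>2
      + (spectral_norm (pinv A) * spectral_norm \<Delta>A * norm y)\<^sup>2"
proof -
  define P where "P = row_projector A"
  define Q where "Q = row_projector (A + \<Delta>A)"
  have P: "orth_projector P" and Q: "orth_projector Q"
    by (simp_all add: P_def Q_def orth_projector_row_projector)
  have Px: "P *v x = x" and Qy: "Q *v y = y"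
    by (simp_all add: P_def Q_def x y matrix_vector_mul_assoc row_projector_pinv)
  have "A *v (y - x) = \<Delta>b - \<Delta>A *v y"
  proof -
    have "A *v x = b" "(A + \<Delta>A) *v y = b + \<Delta>b"
      using b bt by (simp_all only: x y mult_pinv_mult)
    then show ?thesis
      by (simp add: matrix_vector_mult_diff_distrib matrix_vector_mult_add_rdistrib algebra_simps)
  qed
  then have "P *v (y - x) = pinv A *v (\<Delta>b - \<Delta>A *v y)"
    by (simp add: P_def row_projector_def flip: matrix_vector_mul_assoc)
  then have "norm (P *v (y - x)) \<le> spectral_norm (pinv A) * norm (\<Delta>b - \<Delta>A *v y)"
    by (simp add: norm_mult_le_spectral_norm)
  also have "\<dots> \<le> spectral_norm (pinv A) * (norm \<Delta>b + spectral_norm \<Delta>A * norm y)"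
    using norm_triangle_ineq4[of \<Delta>b "\<Delta>A *v y"] norm_mult_le_spectral_norm[of \<Delta>A y]
    by (intro mult_left_mono spectral_norm_nonneg) linarith
  finally have row_part:
    "norm (P *v (y - x)) \<le> spectral_norm (pinv A) * (norm \<Delta>b + spectral_norm \<Delta>A * norm y)" .
  have "norm (Q *v y - P *v (Q *v y)) \<le> spectral_norm (pinv A) * spectral_norm \<Delta>A * norm (Q *v y)"
  proof (rule projector_gap_swap[OF P Q _ _ c])
    show "vec.dim (range (\<lambda>v. P *v v)) = vec.dim (range (\<lambda>v. Q *v v))"
      using rank by (simp add: P_def Q_def dim_range_row_projector)
    show "norm (P *v (v - Q *v v)) \<le> spectral_norm (pinv A) * spectral_norm \<Delta>A * norm v" for v
      using norm_row_projector_gap[of A v "A + \<Delta>A"] by (simp add: P_def Q_def)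
  qed (simp add: spectral_norm_nonneg)
  moreover have "(y - x) - P *v (y - x) = y - P *v y"
    by (simp add: matrix_vector_mult_diff_distrib Px)
  ultimately have kernel_part:
    "norm ((y - x) - P *v (y - x)) \<le> spectral_norm (pinv A) * spectral_norm \<Delta>A * norm y"
    by (simp only: Qy)
  show ?thesis
    unfolding orth_projector_pythagoras[OF P, of "y - x"]
    using row_part kernel_part by (intro add_mono power_mono) auto
qed

text \<open>
Kernels are as far apart as their orthogonal complements.
\<close>

lemma kernel_dist_le:
  fixes A B :: "complex^'n^'m"
  assumes rank: "rank B = rank A"
    and c: "spectral_norm (pinv A) * spectral_norm (B - A) < 1"
  shows "subspace_dist {v. B *v v = 0} {v. A *v v = 0} \<le> spectral_norm (pinv A) * spectral_norm (B - A)"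
proof -
  have "subspace_dist {v. B *v v = 0} {v. A *v v = 0} = spectral_norm (row_projector A - row_projector B)"
    unfolding range_row_projector_complement[symmetric]
    by (subst subspace_dist_eq) (simp_all add: orth_projector_complement orth_projector_row_projector)
  also have "\<dots> \<le> spectral_norm (pinv A) * spectral_norm (B - A)"
    using rank c
    by (intro spectral_norm_projector_diff_le orth_projector_row_projector norm_row_projector_gap)
      (simp_all add: dim_range_row_projector spectral_norm_nonneg)
  finally show ?thesis .
qed

theorem theorem2:
  fixes A \<Delta>A :: "complex^'n^'m" and b \<Delta>b :: "complex^'m" and x :: "complex^'n"
  assumes "A \<noteq> 0"
    and "b \<in> range (\<lambda>u. A *v u)"
    and "rank (A + \<Delta>A) = rank A"
    and "b + \<Delta>b \<in> range (\<lambda>u. (A + \<Delta>A) *v u)"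
    and "x = pinv A *v b"
    and "sqrt 2 * spectral_norm (pinv A) * spectral_norm \<Delta>A < 1"
  shows "affine_dist (sol (A + \<Delta>A) (b + \<Delta>b)) (sol A b)
    \<le> spectral_norm A * spectral_norm (pinv A)
      * (sqrt (2 * (norm x)\<^sup>2 + 1)
         / (spectral_norm A - sqrt 2 * spectral_norm A * spectral_norm (pinv A) * spectral_norm \<Delta>A))
      * pair_norm \<Delta>A \<Delta>b"
proof -
  define \<eta> where "\<eta> = spectral_norm (pinv A)"
  define e where "e = spectral_norm \<Delta>A"
  define y where "y = pinv (A + \<Delta>A) *v (b + \<Delta>b)"
  define q where "q = 1 - sqrt 2 * \<eta> * e"
  define bound where "bound = \<eta> * sqrt (2 * (norm x)\<^sup>2 + 1) / q * sqrt (e\<^sup>2 + (norm \<Delta>b)\<^sup>2)"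
  have nonneg: "0 \<le> \<eta>" "0 \<le> e"
    by (simp_all add: \<eta>_def e_def spectral_norm_nonneg)
  have "1 * (\<eta> * e) \<le> sqrt 2 * (\<eta> * e)"
    using nonneg by (intro mult_right_mono) auto
  then have c: "\<eta> * e < 1"
    using assms(6) by (simp add: \<eta>_def e_def mult.assoc)
  have q: "0 < q" "q \<le> 1"
    using assms(6) nonneg by (simp_all add: q_def \<eta>_def e_def)
  have hat: "norm (y - x) \<le> bound"
    unfolding bound_def q_def
  proof (rule solve_norm_inequality)
    show "(norm (y - x))\<^sup>2 \<le> (\<eta> * (norm \<Delta>b + e * norm y))\<^sup>2 + (\<eta> * e * norm y)\<^sup>2"
      unfolding \<eta>_def e_def
      using norm_min_norm_solution_diff_le[OF assms(2-4) _ assms(5) y_def] c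
      by (simp add: \<eta>_def e_def)
    show "norm y \<le> norm x + norm (y - x)"
      using norm_triangle_ineq[of x "y - x"] by simp
  qed (use nonneg q in \<open>simp_all add: q_def\<close>)
  have "subspace_dist {v. (A + \<Delta>A) *v v = 0} {v. A *v v = 0} \<le> \<eta> * e"
    using kernel_dist_le[of "A + \<Delta>A" A] assms(3) c by (simp add: \<eta>_def e_def)
  also have "\<dots> \<le> bound"
  proof -
    have "1 \<le> sqrt (2 * (norm x)\<^sup>2 + 1) / q"
      using q by (simp add: pos_le_divide_eq order_trans[of q 1])
    moreover have "e \<le> sqrt (e\<^sup>2 + (norm \<Delta>b)\<^sup>2)"
      using nonneg by (intro real_le_rsqrt) simp
    ultimately have "1 * e \<le> sqrt (2 * (norm x)\<^sup>2 + 1) / q * sqrt (e\<^sup>2 + (norm \<Delta>b)\<^sup>2)"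
      using nonneg by (intro mult_mono) auto
    then have "\<eta> * (1 * e) \<le> \<eta> * (sqrt (2 * (norm x)\<^sup>2 + 1) / q * sqrt (e\<^sup>2 + (norm \<Delta>b)\<^sup>2))"
      using nonneg by (intro mult_left_mono)
    then show ?thesis
      by (simp add: bound_def)
  qed
  finally have "affine_dist (sol (A + \<Delta>A) (b + \<Delta>b)) (sol A b) \<le> bound"
    using hat assms(2,4,5) by (simp add: affine_dist_def hat_point_sol direction_sol y_def)
  also have "bound = spectral_norm A * \<eta>
      * (sqrt (2 * (norm x)\<^sup>2 + 1) / (spectral_norm A - sqrt 2 * spectral_norm A * \<eta> * e))
      * pair_norm \<Delta>A \<Delta>b"
  proof -
    have "spectral_norm A - sqrt 2 * spectral_norm A * \<eta> * e = spectral_norm A * q"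
      by (simp add: q_def algebra_simps)
    then show ?thesis
      using spectral_norm_pos[OF assms(1)] by (simp add: bound_def pair_norm_def e_def)
  qed
  finally show ?thesis
    by (simp only: \<eta>_def e_def)
qed

end
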